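(* Let $a\leq b$ be positive integers, where $a$ is odd and $b\equiv 0\pmod 4$, and let $n=ab$. Then $\mathrm{MiD}(L_{a,b})\geq \dfrac{n-\min\{2a,b\}}{2}$.
   Context: A Latin square of order $n$ is an $n\times n$ array with entries from $\{1,2,\dots,n\}$ such that each row and each column contains every symbol exactly once. For positive integers $a,b$ and $n=ab$, an $(a,b)$-Sudoku Latin square is a Latin square of order $n$ such that, when the array is tiled by $a\times b$ blocks ($a$ consecutive rows $ka+1,\dots,(k+1)a$ by $b$ consecutive columns $lb+1,\dots,(l+1)b$), each block contains every symbol of $\{1,\dots,n\}$ exactly once. Two cells are adjacent if they share an edge horizontally or vertically (no wrap-around). The distance between two adjacent cells containing symbols $u,v$ is $\min\{(u-v)\bmod n,\ (v-u)\bmod n\}$, residues being taken in $\{0,\dots,n-1\}$. The inner distance of a Latin square of order $n\ge2$ is the minimum of the distances over all pairs of adjacent cells. $\mathrm{MiD}(L_{a,b})$ denotes the maximum of the inner distances of all $(a,b)$-Sudoku Latin squares. *)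

theory Defs
  imports Complex_Main
begin

text \<open>Arrays of order \<open>n\<close> are functions \<open>L\<close> of a row and a column index; rows, columns and
  symbols are all numbered \<open>1, \<dots>, n\<close>, and values of \<open>L\<close> outside this range are irrelevant.\<close>

definition latin_square :: "nat \<Rightarrow> (nat \<Rightarrow> nat \<Rightarrow> nat) \<Rightarrow> bool" where
  "latin_square n L \<longleftrightarrow>
     (\<forall>i\<in>{1..n}. bij_betw (\<lambda>j. L i j) {1..n} {1..n}) \<and>
     (\<forall>j\<in>{1..n}. bij_betw (\<lambda>i. L i j) {1..n} {1..n})"

text \<open>An array of order \<open>a * b\<close> is tiled by blocks of \<open>a\<close> rows and \<open>b\<close> columns, so there are \<open>b\<close> bands
  of rows (\<open>k < b\<close>) and \<open>a\<close> bands of columns (\<open>l < a\<close>).\<close>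

definition block :: "nat \<Rightarrow> nat \<Rightarrow> nat \<Rightarrow> nat \<Rightarrow> (nat \<times> nat) set" where
  "block a b k l = {k * a + 1..(k + 1) * a} \<times> {l * b + 1..(l + 1) * b}"

definition sudoku_latin_square :: "nat \<Rightarrow> nat \<Rightarrow> (nat \<Rightarrow> nat \<Rightarrow> nat) \<Rightarrow> bool" where
  "sudoku_latin_square a b L \<longleftrightarrow>
     latin_square (a * b) L \<and>
     (\<forall>k<b. \<forall>l<a. bij_betw (\<lambda>(i, j). L i j) (block a b k l) {1..a * b})"

definition cells :: "nat \<Rightarrow> (nat \<times> nat) set" where
  "cells n = {1..n} \<times> {1..n}"

definition adjacent :: "nat \<times> nat \<Rightarrow> nat \<times> nat \<Rightarrow> bool" where
  "adjacent p q \<longleftrightarrow>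
     (fst p = fst q \<and> (snd q = snd p + 1 \<or> snd p = snd q + 1)) \<or>
     (snd p = snd q \<and> (fst q = fst p + 1 \<or> fst p = fst q + 1))"

definition symbol_dist :: "nat \<Rightarrow> nat \<Rightarrow> nat \<Rightarrow> int" where
  "symbol_dist n u v = min ((int u - int v) mod int n) ((int v - int u) mod int n)"

definition adjacent_dists :: "nat \<Rightarrow> (nat \<Rightarrow> nat \<Rightarrow> nat) \<Rightarrow> int set" where
  "adjacent_dists n L =
     {symbol_dist n (L (fst p) (snd p)) (L (fst q) (snd q)) | p q.
        p \<in> cells n \<and> q \<in> cells n \<and> adjacent p q}"

definition inner_distance :: "nat \<Rightarrow> (nat \<Rightarrow> nat \<Rightarrow> nat) \<Rightarrow> int" where
  "inner_distance n L = Min (adjacent_dists n L)"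

definition MiD :: "nat \<Rightarrow> nat \<Rightarrow> int" where
  "MiD a b = Max {inner_distance (a * b) L | L. sudoku_latin_square a b L}"

text \<open>The minimum is over a finite nonempty set as soon as \<open>n \<ge> 2\<close>, and the maximum is over a finite
  set.\<close>

lemma finite_adjacent_dists: "finite (adjacent_dists n L)"
proof -
  have "adjacent_dists n L \<subseteq>
      (\<lambda>(p, q). symbol_dist n (L (fst p) (snd p)) (L (fst q) (snd q))) ` (cells n \<times> cells n)"
    unfolding adjacent_dists_def by force
  then show ?thesis
    by (rule finite_subset) (simp add: cells_def)
qed

lemma adjacent_dists_nonempty:
  assumes "n \<ge> 2"
  shows "adjacent_dists n L \<noteq> {}"
proof -
  have "(1, 1) \<in> cells n" "(1, 2) \<in> cells n" "adjacent (1, 1) (1, 2)"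
    using assms by (auto simp: cells_def adjacent_def)
  then show ?thesis
    unfolding adjacent_dists_def by blast
qed

lemma finite_inner_distances:
  assumes "a * b \<ge> 2"
  shows "finite {inner_distance (a * b) L | L. sudoku_latin_square a b L}"
proof -
  have "inner_distance (a * b) L \<in> {0..<int (a * b)}" for L
  proof -
    have pos: "0 < int (a * b)"
      using assms by linarith
    have "inner_distance (a * b) L \<in> adjacent_dists (a * b) L"
      unfolding inner_distance_def
      by (rule Min_in[OF finite_adjacent_dists adjacent_dists_nonempty[OF assms]])
    then obtain u v where "inner_distance (a * b) L = symbol_dist (a * b) u v"
      unfolding adjacent_dists_def by force
    then show ?thesis
      unfolding symbol_dist_def min_def
      using pos_mod_bound[OF pos, of "int u - int v"] pos_mod_sign[OF pos, of "int u - int v"]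
        pos_mod_bound[OF pos, of "int v - int u"] pos_mod_sign[OF pos, of "int v - int u"]
      by (simp only: atLeastLessThan_iff split: if_split) blast
  qed
  then have "{inner_distance (a * b) L | L. sudoku_latin_square a b L} \<subseteq> {0..<int (a * b)}"
    by blast
  then show ?thesis
    by (rule finite_subset) simp
qed

end

theory Submission
  imports Defs "HOL-Number_Theory.Cong"
begin

text \<open>
  The square is the Cayley table of \<open>\<int>/n\<close> with its rows and columns listed in suitable orders:
  the cell in row \<open>i\<close> and column \<open>j\<close> contains \<open>r i + c j\<close>, where \<open>r\<close> and \<open>c\<close> each run once
  through all residues. Vertical and horizontal neighbours then differ by a step of \<open>r\<close> or \<open>c\<close>,
  and a block contains every symbol as soon as \<open>\<int>/n\<close> is the direct sum of the set of values of
  \<open>r\<close> on a band of rows and the set of values of \<open>c\<close> on a band of columns. So the task is to list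
  \<open>\<int>/n\<close> in two ways, both with all steps close to \<open>n/2\<close>, such that bands are complementary.

  For \<open>n = p q\<close> complementary bands arise from the subgroup \<open>q\<int>/n\<close> of order \<open>p\<close>: let one ordering
  list its cosets one after the other (\<open>coset_order\<close>), and let \<open>q\<close> consecutive terms of the other
  be pairwise incongruent modulo \<open>q\<close>. For the second ordering take the multiples of \<open>n/2 + 1\<close>;
  this generates \<open>\<int>/n\<close> because \<open>n/2\<close> is even, which is where \<open>4 dvd b\<close> enters. Inside a coset the
  first ordering moves by \<open>q h\<close> with \<open>h\<close> coprime to \<open>p\<close>, and the jump to the next coset is
  congruent to \<open>q h + 1 - q\<close>.

  The subgroup can be chosen in two ways. With \<open>p = a\<close> and \<open>q = b\<close>, the choice \<open>h = (a + 1) / 2\<close>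
  gives steps \<open>n/2 + b/2\<close> and \<open>n/2 + 1 - b/2\<close>. With \<open>p = b\<close> and \<open>q = a\<close>, hence with the roles of
  rows and columns exchanged, \<open>h = b/2 + 1\<close> gives steps \<open>n/2 + a\<close> and \<open>n/2 + 1\<close>. The better of
  the two squares has all its steps within \<open>min {2a, b} / 2\<close> of \<open>n/2\<close>.
\<close>

section \<open>Sudoku squares from two orderings of the residues\<close>

definition residue_ordering :: "nat \<Rightarrow> (nat \<Rightarrow> int) \<Rightarrow> bool" where
  "residue_ordering n f \<longleftrightarrow> (\<forall>i<n. \<forall>j<n. [f i = f j] (mod int n) \<longrightarrow> i = j)"

text \<open>Equal quotients by \<open>a\<close> and \<open>b\<close> mean that both cells lie in one block. Since a block has
  \<open>a * b\<close> cells, distinct residues there already exhaust all residues.\<close>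

definition complementary_bands ::
    "nat \<Rightarrow> nat \<Rightarrow> (nat \<Rightarrow> int) \<Rightarrow> (nat \<Rightarrow> int) \<Rightarrow> bool" where
  "complementary_bands a b r c \<longleftrightarrow>
     (\<forall>i<a * b. \<forall>i'<a * b. \<forall>j<a * b. \<forall>j'<a * b.
        i div a = i' div a \<longrightarrow> j div b = j' div b \<longrightarrow>
        [r i + c j = r i' + c j'] (mod int (a * b)) \<longrightarrow> i = i' \<and> j = j')"

text \<open>The orderings are indexed from \<open>0\<close> and residues lie in \<open>{0..<n}\<close>, whereas rows, columns and
  symbols are numbered from \<open>1\<close>; hence the three shifts.\<close>

definition sum_table :: "nat \<Rightarrow> (nat \<Rightarrow> int) \<Rightarrow> (nat \<Rightarrow> int) \<Rightarrow> nat \<Rightarrow> nat \<Rightarrow> nat" where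
  "sum_table n r c i j = nat ((r (i - 1) + c (j - 1)) mod int n) + 1"

lemma sum_table_range:
  assumes "0 < n"
  shows "sum_table n r c i j \<in> {1..n}"
proof -
  have "(r (i - 1) + c (j - 1)) mod int n < int n"
    using assms by simp
  then show ?thesis
    using assms by (simp add: sum_table_def nat_less_iff Suc_le_eq)
qed

lemma int_sum_table:
  assumes "0 < n"
  shows "int (sum_table n r c i j) = (r (i - 1) + c (j - 1)) mod int n + 1"
  using assms by (simp add: sum_table_def)

lemma sum_table_eqD:
  assumes "0 < n" and "sum_table n r c i j = sum_table n r c i' j'"
  shows "[r (i - 1) + c (j - 1) = r (i' - 1) + c (j' - 1)] (mod int n)"
proof -
  have "int (sum_table n r c i j) = int (sum_table n r c i' j')"
    using assms(2) by simp
  then show ?thesis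
    using assms(1) by (simp add: int_sum_table cong_def)
qed

lemma bij_betw_if_card_eq:
  assumes "inj_on f A" and "f ` A \<subseteq> B" and "card A = card B" and "finite B"
  shows "bij_betw f A B"
  using assms by (metis bij_betw_def card_image card_subset_eq)

lemma latin_square_sum_table:
  assumes n: "0 < n" and r: "residue_ordering n r" and c: "residue_ordering n c"
  shows "latin_square n (sum_table n r c)"
  unfolding latin_square_def
proof (intro conjI ballI)
  fix i
  have "inj_on (\<lambda>j. sum_table n r c i j) {1..n}"
  proof (rule inj_onI)
    fix j j'
    assume j: "j \<in> {1..n}" "j' \<in> {1..n}" and eq: "sum_table n r c i j = sum_table n r c i j'"
    have "[c (j - 1) = c (j' - 1)] (mod int n)"
      using sum_table_eqD[OF n eq] by (simp add: cong_add_lcancel)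
    then have "j - 1 = j' - 1"
      using c j unfolding residue_ordering_def by auto
    then show "j = j'"
      using j by auto
  qed
  then show "bij_betw (\<lambda>j. sum_table n r c i j) {1..n} {1..n}"
    using sum_table_range[OF n] by (intro bij_betw_if_card_eq) auto
next
  fix j
  have "inj_on (\<lambda>i. sum_table n r c i j) {1..n}"
  proof (rule inj_onI)
    fix i i'
    assume i: "i \<in> {1..n}" "i' \<in> {1..n}" and eq: "sum_table n r c i j = sum_table n r c i' j"
    have "[r (i - 1) = r (i' - 1)] (mod int n)"
      using sum_table_eqD[OF n eq] by (simp add: cong_add_rcancel)
    then have "i - 1 = i' - 1"
      using r i unfolding residue_ordering_def by auto
    then show "i = i'"
      using i by auto
  qed
  then show "bij_betw (\<lambda>i. sum_table n r c i j) {1..n} {1..n}"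
    using sum_table_range[OF n] by (intro bij_betw_if_card_eq) auto
qed

lemma band_index:
  fixes i k p q :: nat
  assumes "i \<in> {k * p + 1..(k + 1) * p}" and "k < q"
  shows "(i - 1) div p = k" and "i - 1 < p * q"
proof -
  have "k * p \<le> i - 1" "i - 1 < Suc k * p"
    using assms(1) by auto
  then show "(i - 1) div p = k"
    by (simp add: div_nat_eqI mult.commute)
  have "Suc k * p \<le> q * p"
    using assms(2) by (intro mult_le_mono1) simp
  with \<open>i - 1 < Suc k * p\<close> show "i - 1 < p * q"
    by (simp add: mult.commute)
qed

lemma sudoku_latin_square_sum_table:
  assumes n: "0 < a * b"
    and r: "residue_ordering (a * b) r" and c: "residue_ordering (a * b) c"
    and rc: "complementary_bands a b r c"
  shows "sudoku_latin_square a b (sum_table (a * b) r c)"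
  unfolding sudoku_latin_square_def
proof (intro conjI allI impI latin_square_sum_table n r c)
  fix k l assume k: "k < b" and l: "l < a"
  let ?f = "\<lambda>(i, j). sum_table (a * b) r c i j"
  have "inj_on ?f (block a b k l)"
  proof (rule inj_onI, clarify)
    fix i j i' j'
    assume ij: "(i, j) \<in> block a b k l" and ij': "(i', j') \<in> block a b k l"
      and eq: "sum_table (a * b) r c i j = sum_table (a * b) r c i' j'"
    have i: "i \<in> {k * a + 1..(k + 1) * a}" "i' \<in> {k * a + 1..(k + 1) * a}"
      and j: "j \<in> {l * b + 1..(l + 1) * b}" "j' \<in> {l * b + 1..(l + 1) * b}"
      using ij ij' unfolding block_def by blast+
    have "i - 1 = i' - 1 \<and> j - 1 = j' - 1"
      using rc sum_table_eqD[OF n eq] band_index[OF i(1) k] band_index[OF i(2) k]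
        band_index[OF j(1) l] band_index[OF j(2) l]
      unfolding complementary_bands_def by (simp add: mult.commute[of b a])
    then show "i = i' \<and> j = j'"
      using i j by auto
  qed
  moreover have "card (block a b k l) = card {1..a * b}"
    by (simp add: block_def card_cartesian_product algebra_simps)
  ultimately show "bij_betw ?f (block a b k l) {1..a * b}"
    using sum_table_range[OF n] by (intro bij_betw_if_card_eq) auto
qed

section \<open>Inner distance of a sum table\<close>

lemma symbol_dist_ge:
  assumes n: "0 < n" and cong: "[int v - int u = z] (mod int n)"
    and z: "D \<le> z" "z \<le> int n - D"
  shows "D \<le> symbol_dist n u v"
proof (cases "0 < D")
  case True
  have "(int v - int u) mod int n = z"
    using cong z True by (simp add: cong_def)
  moreover from this have "(int u - int v) mod int n = int n - z"
    using z True zmod_zminus1_eq_if[of "int v - int u" "int n"] by simp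
  ultimately show ?thesis
    using z by (simp add: symbol_dist_def)
next
  case False
  have "0 \<le> symbol_dist n u v"
    using n by (simp add: symbol_dist_def)
  with False show ?thesis
    by linarith
qed

lemma symbol_dist_commute: "symbol_dist n u v = symbol_dist n v u"
  by (simp add: symbol_dist_def min.commute)

text \<open>The interval is symmetric about \<open>n/2\<close>, because a step and its inverse give the same
  distance.\<close>

definition steps_at_least :: "nat \<Rightarrow> int \<Rightarrow> (nat \<Rightarrow> int) \<Rightarrow> bool" where
  "steps_at_least n D f \<longleftrightarrow>
     (\<forall>i. \<exists>z. [f (Suc i) - f i = z] (mod int n) \<and> D \<le> z \<and> z \<le> int n - D)"

lemma inner_distance_sum_table_ge:
  assumes n: "2 \<le> n" and r: "steps_at_least n D r" and c: "steps_at_least n D c"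
  shows "D \<le> inner_distance n (sum_table n r c)"
proof -
  let ?L = "sum_table n r c"
  have n0: "0 < n"
    using n by simp
  have diff: "[int (?L i' j') - int (?L i j)
      = (r (i' - 1) + c (j' - 1)) - (r (i - 1) + c (j - 1))] (mod int n)" for i j i' j'
    using n0 by (simp add: int_sum_table cong_def mod_diff_eq)
  have vertical: "D \<le> symbol_dist n (?L i j) (?L (Suc i) j)" if "1 \<le> i" for i j
  proof -
    obtain z where z: "[r (Suc (i - 1)) - r (i - 1) = z] (mod int n)" "D \<le> z" "z \<le> int n - D"
      using r unfolding steps_at_least_def by blast
    have "[int (?L (Suc i) j) - int (?L i j) = z] (mod int n)"
      using cong_trans[OF diff[of "Suc i" j i j], of z] z(1) that by simp
    with z n0 show ?thesis
      by (intro symbol_dist_ge)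
  qed
  have horizontal: "D \<le> symbol_dist n (?L i j) (?L i (Suc j))" if "1 \<le> j" for i j
  proof -
    obtain z where z: "[c (Suc (j - 1)) - c (j - 1) = z] (mod int n)" "D \<le> z" "z \<le> int n - D"
      using c unfolding steps_at_least_def by blast
    have "[int (?L i (Suc j)) - int (?L i j) = z] (mod int n)"
      using cong_trans[OF diff[of i "Suc j" i j], of z] z(1) that by simp
    with z n0 show ?thesis
      by (intro symbol_dist_ge)
  qed
  have "D \<le> d" if d: "d \<in> adjacent_dists n ?L" for d
  proof -
    obtain i j i' j' where deq: "d = symbol_dist n (?L i j) (?L i' j')"
      and cells: "(i, j) \<in> cells n" "(i', j') \<in> cells n" and adj: "adjacent (i, j) (i', j')"
      using d unfolding adjacent_dists_def by auto
    have pos: "1 \<le> i" "1 \<le> j" "1 \<le> i'" "1 \<le> j'"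
      using cells by (auto simp: cells_def)
    consider "i' = i" "j' = Suc j" | "i' = i" "j = Suc j'" | "j' = j" "i' = Suc i" | "j' = j" "i = Suc i'"
      using adj unfolding adjacent_def by auto
    then show ?thesis
      using vertical horizontal pos deq symbol_dist_commute by cases metis+
  qed
  then show ?thesis
    unfolding inner_distance_def
    using finite_adjacent_dists adjacent_dists_nonempty[OF n] by (intro Min.boundedI)
qed

section \<open>The two orderings\<close>

lemma residue_ordering_multiples:
  assumes "coprime w (int n)"
  shows "residue_ordering n (\<lambda>i. int i * w)"
  unfolding residue_ordering_def
  using assms by (auto simp: cong_mult_rcancel cong_int_iff dest: cong_less_modulus_unique_nat)

text \<open>For \<open>h\<close> coprime to \<open>p\<close>, band \<open>k\<close> of \<open>p\<close> terms runs through the coset of \<open>k\<close> modulo \<open>q\<close>. The start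
  \<open>k * (1 - q)\<close> of the band is chosen among the elements of this coset so that the jump between
  bands falls short of the regular step \<open>q * h\<close> by \<open>q - 1\<close>.\<close>

definition coset_order :: "nat \<Rightarrow> nat \<Rightarrow> int \<Rightarrow> nat \<Rightarrow> int" where
  "coset_order p q h i = int (i div p) * (1 - int q) + int q * h * int (i mod p)"

lemma coset_order_cong: "[coset_order p q h i = int (i div p)] (mod int q)"
proof -
  have "coset_order p q h i - int (i div p) = int q * (h * int (i mod p) - int (i div p))"
    by (simp add: coset_order_def algebra_simps)
  then show ?thesis
    by (simp add: cong_iff_dvd_diff)
qed

text \<open>The residue modulo \<open>q\<close> determines the band, and within a band the multiples of \<open>q * h\<close>
  are distinct because \<open>h\<close> is coprime to \<open>p\<close>.\<close>

lemma residue_ordering_coset_order: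
  assumes p: "0 < p" and q: "0 < q" and h: "coprime h (int p)"
  shows "residue_ordering (p * q) (coset_order p q h)"
  unfolding residue_ordering_def
proof (intro allI impI)
  fix i j
  assume ij: "i < p * q" "j < p * q"
    and eq: "[coset_order p q h i = coset_order p q h j] (mod int (p * q))"
  have "[coset_order p q h i = coset_order p q h j] (mod int q)"
    using eq by (rule cong_dvd_modulus) simp
  then have "[int (i div p) = int (j div p)] (mod int q)"
    using coset_order_cong cong_sym cong_trans by metis
  moreover have "i div p < q" "j div p < q"
    using ij by (simp_all add: less_mult_imp_div_less mult.commute)
  ultimately have same_band: "i div p = j div p"
    by (simp add: cong_int_iff cong_less_modulus_unique_nat)
  then have "[int q * (h * int (i mod p)) = int q * (h * int (j mod p))] (mod int q * int p)"
    using eq by (simp add: coset_order_def cong_add_lcancel mult.assoc mult.commute[of "int p"])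
  then have "int q * int p dvd int q * (h * int (i mod p) - h * int (j mod p))"
    by (simp add: cong_iff_dvd_diff right_diff_distrib)
  then have "[h * int (i mod p) = h * int (j mod p)] (mod int p)"
    using q by (simp add: cong_iff_dvd_diff)
  then have "[i mod p = j mod p] (mod p)"
    using h by (simp add: cong_mult_lcancel cong_int_iff)
  then have "i mod p = j mod p"
    by (simp add: cong_def)
  with same_band show "i = j"
    by (metis div_mult_mod_eq)
qed

text \<open>Modulo \<open>q\<close> the first summand is constant on a band of \<open>p\<close> terms, so equal sums have
  \<open>j * w\<close> and \<open>j' * w\<close> congruent modulo \<open>q\<close>; a band of \<open>q\<close> terms meets each residue modulo
  \<open>q\<close> only once.\<close>

lemma complementary_bands_coset_order_multiples:
  assumes p: "0 < p" and q: "0 < q" and h: "coprime h (int p)" and w: "coprime w (int (p * q))"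
  shows "complementary_bands p q (coset_order p q h) (\<lambda>j. int j * w)"
  unfolding complementary_bands_def
proof (intro allI impI)
  fix i i' j j'
  assume lt: "i < p * q" "i' < p * q" "j < p * q" "j' < p * q"
    and bands: "i div p = i' div p" "j div q = j' div q"
    and eq: "[coset_order p q h i + int j * w = coset_order p q h i' + int j' * w]
      (mod int (p * q))"
  have "[coset_order p q h i + int j * w = coset_order p q h i' + int j' * w] (mod int q)"
    using eq by (rule cong_dvd_modulus) simp
  moreover have "[coset_order p q h i = coset_order p q h i'] (mod int q)"
    using coset_order_cong[of p q h i] coset_order_cong[of p q h i'] bands(1)
    by (metis cong_sym cong_trans)
  ultimately have "[int j * w = int j' * w] (mod int q)"
    by (metis cong_add_lcancel cong_add_rcancel cong_sym cong_trans)
  then have "[j = j'] (mod q)"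
    using w by (simp add: cong_mult_rcancel cong_int_iff)
  then have "j = j'"
    using bands(2) by (metis cong_def div_mult_mod_eq)
  moreover from this have "[coset_order p q h i = coset_order p q h i'] (mod int (p * q))"
    using eq by (simp add: cong_add_rcancel)
  then have "i = i'"
    using residue_ordering_coset_order[OF p q h] lt unfolding residue_ordering_def by blast
  ultimately show "i = i' \<and> j = j'"
    by simp
qed

lemma complementary_bands_swap:
  assumes "complementary_bands p q r c"
  shows "complementary_bands q p c r"
  using assms unfolding complementary_bands_def by (simp add: add.commute mult.commute)

lemma steps_at_least_multiples:
  assumes "D \<le> w" and "w \<le> int n - D"
  shows "steps_at_least n D (\<lambda>i. int i * w)"
proof -
  have "int (Suc i) * w - int i * w = w" for i
    by (simp add: algebra_simps)
  then show ?thesis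
    unfolding steps_at_least_def using assms by (metis cong_refl)
qed

text \<open>At the end of a band the sequence moves by \<open>1 - q - q h (p - 1)\<close>, which is
  \<open>q h + 1 - q\<close> modulo \<open>p q\<close>.\<close>

lemma steps_at_least_coset_order:
  assumes "0 < p"
    and "D \<le> int q * h" "int q * h \<le> int (p * q) - D"
    and "D \<le> int q * h + 1 - int q" "int q * h + 1 - int q \<le> int (p * q) - D"
  shows "steps_at_least (p * q) D (coset_order p q h)"
  unfolding steps_at_least_def
proof
  fix i
  show "\<exists>z. [coset_order p q h (Suc i) - coset_order p q h i = z] (mod int (p * q)) \<and>
      D \<le> z \<and> z \<le> int (p * q) - D"
  proof (cases "Suc (i mod p) = p")
    case True
    have last: "int (i mod p) = int p - 1"
      using True by linarith
    have "coset_order p q h (Suc i) - coset_order p q h i - (int q * h + 1 - int q)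
        = int (p * q) * (- h)"
      using True by (simp add: coset_order_def div_Suc mod_Suc last algebra_simps)
    then have "[coset_order p q h (Suc i) - coset_order p q h i = int q * h + 1 - int q]
        (mod int (p * q))"
      by (metis cong_iff_dvd_diff dvd_triv_left)
    with assms show ?thesis
      by blast
  next
    case False
    have "coset_order p q h (Suc i) - coset_order p q h i = int q * h"
      using False by (simp add: coset_order_def div_Suc mod_Suc algebra_simps)
    with assms show ?thesis
      by (metis cong_refl)
  qed
qed

section \<open>The two squares and the bound\<close>

lemma MiD_ge:
  assumes "2 \<le> a * b" and "sudoku_latin_square a b L" and "D \<le> inner_distance (a * b) L"
  shows "D \<le> MiD a b"
proof -
  have "inner_distance (a * b) L \<le> MiD a b"
    unfolding MiD_def using assms(2) by (intro Max_ge[OF finite_inner_distances[OF assms(1)]]) blast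
  with assms(3) show ?thesis
    by linarith
qed

lemma MiD_ge_if_orderings:
  assumes "2 \<le> a * b" and "residue_ordering (a * b) r" and "residue_ordering (a * b) c"
    and "complementary_bands a b r c"
    and "steps_at_least (a * b) D r" and "steps_at_least (a * b) D c"
  shows "D \<le> MiD a b"
proof (rule MiD_ge[OF assms(1)])
  show "sudoku_latin_square a b (sum_table (a * b) r c)"
    using assms by (intro sudoku_latin_square_sum_table) linarith+
  show "D \<le> inner_distance (a * b) (sum_table (a * b) r c)"
    using assms by (intro inner_distance_sum_table_ge)
qed

lemma coprime_even_Suc_double:
  fixes m :: int
  assumes "even m"
  shows "coprime (m + 1) (2 * m)"
proof -
  have "coprime (m + 1) m"
    by (rule coprimeI) (metis dvd_add_right_iff)
  moreover have "coprime (m + 1) 2"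
    using assms by (simp add: coprime_right_2_iff_odd)
  ultimately show ?thesis
    by simp
qed

theorem theorem4p8:
  fixes a b n :: nat
  assumes "0 < a" and "0 < b" and "a \<le> b"
    and "odd a"
    and "b mod 4 = 0"
    and "n = a * b"
  shows "real_of_int (MiD a b) \<ge> (real n - real (min (2 * a) b)) / 2"
proof -
  obtain s where a: "a = 2 * s + 1"
    using \<open>odd a\<close> by (rule oddE)
  obtain t where b: "b = 4 * t"
    using \<open>b mod 4 = 0\<close> by auto
  have t: "1 \<le> t"
    using \<open>0 < b\<close> b by simp
  \<comment> \<open>\<open>m\<close> is half the order of the square.\<close>
  define m where "m = int a * (2 * int t)"
  have n: "int (a * b) = 2 * m" "int (b * a) = 2 * m"
    by (simp_all add: m_def b)
  have two: "2 \<le> a * b"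
    using \<open>0 < a\<close> t b by (simp add: Suc_le_eq)
  have w: "coprime (m + 1) (int (a * b))" "coprime (m + 1) (int (b * a))"
    unfolding n by (rule coprime_even_Suc_double, simp add: m_def)+
  show ?thesis
  proof (cases "2 * a \<le> b")
    case True
    have h: "coprime (2 * int t + 1) (int b)"
      using coprime_even_Suc_double[of "2 * int t"] by (simp add: b)
    have qh: "int a * (2 * int t + 1) = m + int a"
      by (simp add: m_def algebra_simps)
    have "m - int a \<le> MiD a b"
    proof (rule MiD_ge_if_orderings[OF two])
      show "residue_ordering (a * b) (\<lambda>i. int i * (m + 1))"
        by (rule residue_ordering_multiples[OF w(1)])
      show "residue_ordering (a * b) (coset_order b a (2 * int t + 1))"
        using residue_ordering_coset_order[OF \<open>0 < b\<close> \<open>0 < a\<close> h] by (simp add: mult.commute)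
      show "complementary_bands a b (\<lambda>i. int i * (m + 1)) (coset_order b a (2 * int t + 1))"
        by (rule complementary_bands_swap[OF
              complementary_bands_coset_order_multiples[OF \<open>0 < b\<close> \<open>0 < a\<close> h w(2)]])
      show "steps_at_least (a * b) (m - int a) (\<lambda>i. int i * (m + 1))"
        using \<open>0 < a\<close> by (intro steps_at_least_multiples; simp only: n; simp)
      have "steps_at_least (b * a) (m - int a) (coset_order b a (2 * int t + 1))"
        using \<open>0 < a\<close> by (intro steps_at_least_coset_order \<open>0 < b\<close>; simp only: n qh; simp)
      then show "steps_at_least (a * b) (m - int a) (coset_order b a (2 * int t + 1))"
        by (simp add: mult.commute)
    qed
    then have "real_of_int (m - int a) \<le> real_of_int (MiD a b)"
      by (simp only: of_int_le_iff)
    moreover have "(real n - real (min (2 * a) b)) / 2 = real_of_int (m - int a)"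
      using True \<open>n = a * b\<close> by (simp add: m_def b)
    ultimately show ?thesis
      by linarith
  next
    case False
    have "coprime (int s + 1) (int a)"
    proof (rule coprimeI)
      fix d assume "d dvd int s + 1" "d dvd int a"
      moreover have "1 = 2 * (int s + 1) - int a"
        by (simp add: a)
      ultimately show "d dvd 1"
        by (metis dvd_diff dvd_mult)
    qed
    note h = this
    have qh: "int b * (int s + 1) = m + 2 * int t"
      by (simp add: m_def a b algebra_simps)
    have "m - 2 * int t \<le> MiD a b"
    proof (rule MiD_ge_if_orderings[OF two])
      show "residue_ordering (a * b) (coset_order a b (int s + 1))"
        by (rule residue_ordering_coset_order[OF \<open>0 < a\<close> \<open>0 < b\<close> h])
      show "residue_ordering (a * b) (\<lambda>j. int j * (m + 1))"
        by (rule residue_ordering_multiples[OF w(1)])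
      show "complementary_bands a b (coset_order a b (int s + 1)) (\<lambda>j. int j * (m + 1))"
        by (rule complementary_bands_coset_order_multiples[OF \<open>0 < a\<close> \<open>0 < b\<close> h w(1)])
      show "steps_at_least (a * b) (m - 2 * int t) (coset_order a b (int s + 1))"
        using t by (intro steps_at_least_coset_order \<open>0 < a\<close>; simp only: n qh; simp add: b)
      show "steps_at_least (a * b) (m - 2 * int t) (\<lambda>j. int j * (m + 1))"
        using t by (intro steps_at_least_multiples; simp only: n; simp)
    qed
    then have "real_of_int (m - 2 * int t) \<le> real_of_int (MiD a b)"
      by (simp only: of_int_le_iff)
    moreover have "(real n - real (min (2 * a) b)) / 2 = real_of_int (m - 2 * int t)"
      using False \<open>n = a * b\<close> by (simp add: m_def b)
    ultimately show ?thesis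
      by linarith
  qed
qed

end
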